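(* Let $D$ be a multipartite tournament having exactly two partite sets that are not $\{1,2\}$-competing. Then the following are equivalent: (i) $C_{1,2}(D)$ is an interval graph; (ii) $C_{1,2}(D)$ is chordal; (iii) $C_{1,2}(D)$ has no induced cycle of length four. In particular, if all partite sets of $D$ except possibly one have at most three vertices, then $C_{1,2}(D)$ is an interval graph.
   Context: All graphs and digraphs are finite and simple. For a digraph $D$, $d_D(x,y)$ is the length of a shortest directed path from $x$ to $y$. The $(1,2)$-step competition graph $C_{1,2}(D)$ is the graph on $V(D)$ in which distinct $u,v$ are adjacent iff there is a vertex $w\notin\{u,v\}$ with either $d_{D-v}(u,w)\le 1$ and $d_{D-u}(v,w)\le 2$, or $d_{D-u}(v,w)\le 1$ and $d_{D-v}(u,w)\le 2$. A multipartite tournament is an orientation of a complete $k$-partite graph for some $k\ge3$ (with nonempty partite sets). A set of vertices is $\{1,2\}$-competing if it is a clique in $C_{1,2}(D)$. A graph is an interval graph if its vertices can be assigned real intervals so that two distinct vertices are adjacent iff their intervals intersect; it is chordal if it has no induced cycle of length at least four. *)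

theory Defs
  imports
    "HOL-Analysis.Analysis"
    "HOL-Library.Disjoint_Sets"
    "HOL-Library.Extended_Nat"
    "Graph_Theory.Graph_Theory"
begin

text \<open>Digraphs are finite, without loops or parallel arcs (locale \<^locale>\<open>digraph\<close>). Undirected
  simple graphs are represented by symmetric arc sets (locale \<^locale>\<open>pair_graph\<close>).\<close>

text \<open>The infimum over the empty set is \<open>\<infinity>\<close>, so the distance is infinite if there is no path.\<close>

definition ddist :: "('a, 'b) pre_digraph \<Rightarrow> 'a \<Rightarrow> 'a \<Rightarrow> enat" where
  "ddist D x y = (INF p \<in> {p. pre_digraph.apath D x p y}. enat (length p))"

definition step_competes :: "('a, 'b) pre_digraph \<Rightarrow> 'a \<Rightarrow> 'a \<Rightarrow> bool" where
  "step_competes D u v \<longleftrightarrow>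
     (\<exists>w \<in> verts D. w \<notin> {u, v} \<and>
        (ddist (pre_digraph.del_vert D v) u w \<le> 1 \<and> ddist (pre_digraph.del_vert D u) v w \<le> 2 \<or>
         ddist (pre_digraph.del_vert D u) v w \<le> 1 \<and> ddist (pre_digraph.del_vert D v) u w \<le> 2))"

definition step_competition_graph :: "('a, 'b) pre_digraph \<Rightarrow> 'a pair_pre_digraph" where
  "step_competition_graph D =
     \<lparr> pverts = verts D,
       parcs = {(u, v). u \<in> verts D \<and> v \<in> verts D \<and> u \<noteq> v \<and> step_competes D u v} \<rparr>"

lemma step_competes_sym: "step_competes D u v \<longleftrightarrow> step_competes D v u"
  unfolding step_competes_def by auto

lemma pair_graph_step_competition_graph:
  assumes "digraph D"
  shows "pair_graph (step_competition_graph D)"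
proof -
  interpret digraph D by fact
  have "parcs (step_competition_graph D) \<subseteq> verts D \<times> verts D"
    by (auto simp: step_competition_graph_def)
  then have "finite (parcs (step_competition_graph D))"
    by (rule finite_subset) simp
  then show ?thesis
    by unfold_locales
      (auto simp: step_competition_graph_def arcs_ends_def arc_to_ends_def symmetric_def sym_def
         intro: step_competes_sym[THEN iffD1])
qed

text \<open>\<open>P\<close> is the set of partite sets; \<^const>\<open>partition_on\<close> makes them nonempty and pairwise disjoint.
  The last conjunct says that \<open>D\<close> is an orientation of the complete multipartite graph with partite
  sets \<open>P\<close>.\<close>

definition multipartite_tournament :: "('a, 'b) pre_digraph \<Rightarrow> 'a set set \<Rightarrow> bool" where
  "multipartite_tournament D P \<longleftrightarrow>
     digraph D \<and> partition_on (verts D) P \<and> card P \<ge> 3 \<and>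
     (\<forall>X \<in> P. \<forall>Y \<in> P. \<forall>u \<in> X. \<forall>v \<in> Y.
        if X = Y then (u, v) \<notin> arcs_ends D
        else ((u, v) \<in> arcs_ends D) \<noteq> ((v, u) \<in> arcs_ends D))"

definition is_clique :: "'a pair_pre_digraph \<Rightarrow> 'a set \<Rightarrow> bool" where
  "is_clique G X \<longleftrightarrow> X \<subseteq> pverts G \<and> (\<forall>u \<in> X. \<forall>v \<in> X. u \<noteq> v \<longrightarrow> (u, v) \<in> parcs G)"

definition step_competing :: "('a, 'b) pre_digraph \<Rightarrow> 'a set \<Rightarrow> bool" where
  "step_competing D X \<longleftrightarrow> is_clique (step_competition_graph D) X"

definition interval_graph :: "'a pair_pre_digraph \<Rightarrow> bool" where
  "interval_graph G \<longleftrightarrow>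
     (\<exists>I :: 'a \<Rightarrow> real set.
        (\<forall>v \<in> pverts G. is_interval (I v) \<and> I v \<noteq> {}) \<and>
        (\<forall>u \<in> pverts G. \<forall>v \<in> pverts G. u \<noteq> v \<longrightarrow> ((u, v) \<in> parcs G \<longleftrightarrow> I u \<inter> I v \<noteq> {})))"

text \<open>An induced cycle is given by the cyclic sequence of its vertices; this is meaningful for
  length at least three.\<close>

definition induced_cycle :: "'a pair_pre_digraph \<Rightarrow> 'a list \<Rightarrow> bool" where
  "induced_cycle G vs \<longleftrightarrow>
     length vs \<ge> 3 \<and> distinct vs \<and> set vs \<subseteq> pverts G \<and>
     (\<forall>i < length vs. \<forall>j < length vs.
        (vs ! i, vs ! j) \<in> parcs G \<longleftrightarrow> j = Suc i mod length vs \<or> i = Suc j mod length vs)"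

definition chordal :: "'a pair_pre_digraph \<Rightarrow> bool" where
  "chordal G \<longleftrightarrow> \<not> (\<exists>vs. induced_cycle G vs \<and> length vs \<ge> 4)"

end

theory Submission
  imports Defs
begin

text \<open>
  Call two vertices linked if they do not compete, let \<open>N u\<close> be the out-neighbourhood of \<open>u\<close>, and
  let \<open>X\<close> and \<open>Y\<close> be the two partite sets that are not competing. An induced four-cycle of the
  competition graph is an induced \<open>2K\<^sub>2\<close> of its complement, the graph of links. If there is none and
  the links have a transitive orientation, this orientation is an interval order, hence the
  competition graph is an interval graph.

  Every vertex outside \<open>X\<close> dominates a vertex of \<open>X\<close>, since linked vertices have disjoint
  out-neighbourhoods, and similarly for \<open>Y\<close>. It follows that all links are inside \<open>X \<union> Y\<close>, that
  vertices of \<open>X\<close> are linked iff their out-neighbourhoods are disjoint subsets of \<open>Y\<close>, and that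
  \<open>x \<in> X\<close> and \<open>y \<in> Y\<close> are linked iff \<open>N x = {y}\<close> or \<open>N y = {x}\<close>. If \<open>N y = {x}\<close>, then \<open>x\<close> is an end
  of all links inside \<open>X\<close>. Without an induced \<open>2K\<^sub>2\<close> there is such an out-neighbourhood, say
  \<open>N y = {x}\<close>. If all singleton out-neighbourhoods belong to vertices of \<open>Y\<close>, the graph of links is
  bipartite. If also \<open>N x' = {y'}\<close>, then \<open>x\<close> and \<open>y'\<close> are linked, and if \<open>u \<in> X - {x}\<close> is linked to
  \<open>v \<in> Y - {y'}\<close>, then \<open>u\<close> is linked to \<open>x\<close> and \<open>v\<close> to \<open>y'\<close>, so that orienting the links along
  \<open>{x} < Y - {y'} < X - {x} < {y'}\<close> is transitive.

  If \<open>X\<close> has at most three vertices, every link inside \<open>Y\<close> has an end with a singleton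
  out-neighbourhood, and this excludes an induced \<open>2K\<^sub>2\<close>.
\<close>

section \<open>Interval graphs are chordal\<close>

lemma nonconsecutive_intervals_meet:
  fixes A B C D :: "real set"
  assumes "is_interval B" "is_interval C"
    and p: "p \<in> A" "p \<in> B" and q: "q \<in> B" "q \<in> C" and r: "r \<in> C" "r \<in> D"
    and le: "q \<le> p" "q \<le> r"
  shows "A \<inter> C \<noteq> {} \<or> B \<inter> D \<noteq> {}"
proof (cases "p \<le> r")
  case True
  then have "p \<in> C"
    using mem_is_interval_1_I[of C q r p] assms by blast
  then show ?thesis using p by blast
next
  case False
  then have "r \<in> B"
    using mem_is_interval_1_I[of B q p r] assms by simp
  then show ?thesis using r by blast
qed

lemma induced_cycle_nth_mod:
  assumes cycle: "induced_cycle G vs" and len: "length vs \<ge> 4"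
  defines "w k \<equiv> vs ! (k mod length vs)"
  shows "w k \<in> pverts G"
    and "w k \<noteq> w (k + 1)" "(w k, w (k + 1)) \<in> parcs G"
    and "w k \<noteq> w (k + 2)" "(w k, w (k + 2)) \<notin> parcs G"
proof -
  define n where "n = length vs"
  define i where "i = k mod n"
  have n: "n \<ge> 4" and i: "i < n"
    using len by (auto simp: n_def i_def intro: mod_less_divisor)
  have pos: "j mod n < n" for j
    using n by simp
  have shift: "(k + c) mod n = (if i + c < n then i + c else i + c - n)" if "c \<le> n" for c
  proof -
    have "(k + c) mod n = (i + c) mod n"
      by (simp add: i_def mod_add_left_eq)
    then show ?thesis
      using that i by (simp add: le_mod_geq)
  qed
  have arc: "(w j, w l) \<in> parcs G \<longleftrightarrow> l mod n = (j + 1) mod n \<or> j mod n = (l + 1) mod n" for j l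
    using cycle pos[of j] pos[of l] by (simp add: induced_cycle_def w_def n_def mod_Suc_eq)
  have eq: "w j = w l \<longleftrightarrow> j mod n = l mod n" for j l
    using cycle pos by (simp add: induced_cycle_def w_def n_def nth_eq_iff_index_eq)
  show "w k \<in> pverts G"
    using cycle pos unfolding induced_cycle_def w_def n_def by (meson nth_mem subsetD)
  show "(w k, w (k + 1)) \<in> parcs G"
    by (simp add: arc)
  show "w k \<noteq> w (k + 1)" "w k \<noteq> w (k + 2)"
    using shift[of 1] shift[of 2] i n by (auto simp: eq i_def)
  have "(k + 2) mod n \<noteq> (k + 1) mod n" "i \<noteq> (k + 3) mod n"
    using shift[of 1] shift[of 2] shift[of 3] i n by auto
  then show "(w k, w (k + 2)) \<notin> parcs G"
    by (simp add: arc i_def numeral_3_eq_3)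
qed

lemma periodic_attains_min:
  fixes f :: "nat \<Rightarrow> 'a :: linorder"
  assumes "n > 0" and periodic: "\<And>k. f (k + n) = f k"
  obtains m where "\<And>k. f m \<le> f k"
proof -
  have "f (r + q * n) = f r" for r q
  proof (induction q)
    case (Suc q)
    then show ?case
      using periodic[of "r + q * n"] by (simp add: ac_simps)
  qed simp
  then have "f k = f (k mod n)" for k
    using mod_mult_div_eq[of k n] by (metis mult.commute)
  moreover have "k mod n \<in> {..<n}" for k
    using assms(1) by simp
  ultimately have "range f \<subseteq> f ` {..<n}"
    by (metis image_subsetI image_eqI)
  then have "finite (range f)"
    by (rule finite_subset) simp
  then show thesis
    using that ex_min_if_finite[of "range f"] by (auto simp: not_less)
qed

lemma periodic_intervals_chord:
  fixes J :: "nat \<Rightarrow> real set"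
  assumes "n > 0" and periodic: "\<And>k. J (k + n) = J k"
    and interval: "\<And>k. is_interval (J k)"
    and meet: "\<And>k. J k \<inter> J (k + 1) \<noteq> {}"
  obtains k where "J k \<inter> J (k + 2) \<noteq> {}"
proof -
  define p where "p k = (SOME x. x \<in> J k \<inter> J (k + 1))" for k
  have p: "p k \<in> J k" "p k \<in> J (k + 1)" for k
    using meet[of k] some_in_eq[of "J k \<inter> J (k + 1)"] by (auto simp: p_def)
  have p_periodic: "p (k + n) = p k" for k
    using periodic[of k] periodic[of "k + 1"] by (simp add: p_def)
  then obtain m where m: "\<And>k. p m \<le> p k"
    using periodic_attains_min[of n p] assms(1) by metis
  \<comment> \<open>The two intervals through the leftmost of the points \<open>p k\<close> both extend to the right, up to
    the next points, so the one whose next point is further contains a point of a third interval.\<close>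
  define k where "k = m + (n - 1)"
  have "k + 1 = m + n"
    using assms(1) by (simp add: k_def)
  then have "p (k + 1) = p m"
    by (simp only: p_periodic)
  then have "p (k + 1) \<le> p k" "p (k + 1) \<le> p (k + 2)"
    using m by simp_all
  then have "J k \<inter> J (k + 2) \<noteq> {} \<or> J (k + 1) \<inter> J (k + 1 + 2) \<noteq> {}"
    using nonconsecutive_intervals_meet[of "J (k + 1)" "J (k + 2)" "p k" "J k"
        "p (k + 1)" "p (k + 2)" "J (k + 3)"]
      p[of k] p[of "k + 1"] p[of "k + 2"] interval
    by (simp add: numeral_2_eq_2 numeral_3_eq_3)
  then show thesis
    using that by blast
qed

lemma interval_graph_imp_chordal:
  assumes "interval_graph G"
  shows "chordal G"
  unfolding chordal_def
proof
  assume "\<exists>vs. induced_cycle G vs \<and> length vs \<ge> 4"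
  then obtain vs where cycle: "induced_cycle G vs" and len: "length vs \<ge> 4"
    by blast
  obtain I :: "'a \<Rightarrow> real set"
    where interval: "\<And>v. v \<in> pverts G \<Longrightarrow> is_interval (I v)"
      and adj: "\<And>u v. u \<in> pverts G \<Longrightarrow> v \<in> pverts G \<Longrightarrow> u \<noteq> v \<Longrightarrow>
        (u, v) \<in> parcs G \<longleftrightarrow> I u \<inter> I v \<noteq> {}"
    using assms unfolding interval_graph_def by metis
  define w where "w k = vs ! (k mod length vs)" for k
  note w = induced_cycle_nth_mod[OF cycle len, folded w_def]
  have meet: "I (w k) \<inter> I (w (k + 1)) \<noteq> {}" and no_chord: "I (w k) \<inter> I (w (k + 2)) = {}" for k
    using w adj by blast+
  have "length vs > 0"
    using len by linarith
  moreover have "I (w (k + length vs)) = I (w k)" for k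
    by (simp add: w_def)
  moreover have "is_interval (I (w k))" for k
    using interval w(1) .
  ultimately obtain k where "I (w k) \<inter> I (w (k + 2)) \<noteq> {}"
    using meet by (rule periodic_intervals_chord)
  with no_chord show False
    by blast
qed

section \<open>Cocomparability graphs without induced four-cycles\<close>

definition nonadjacent :: "'a pair_pre_digraph \<Rightarrow> 'a \<Rightarrow> 'a \<Rightarrow> bool" where
  "nonadjacent G u v \<longleftrightarrow> u \<in> pverts G \<and> v \<in> pverts G \<and> u \<noteq> v \<and> (u, v) \<notin> parcs G"

definition complement_2K2_free :: "'a pair_pre_digraph \<Rightarrow> bool" where
  "complement_2K2_free G \<longleftrightarrow> (\<forall>a b c d. nonadjacent G a b \<longrightarrow> nonadjacent G c d \<longrightarrow>
     (\<exists>u \<in> {a, b}. \<exists>v \<in> {c, d}. u = v \<or> nonadjacent G u v))"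

definition cocomparability_graph :: "'a pair_pre_digraph \<Rightarrow> bool" where
  "cocomparability_graph G \<longleftrightarrow>
     (\<exists>R. transp R \<and> (\<forall>u v. nonadjacent G u v \<longleftrightarrow> R u v \<or> R v u))"

lemma (in pair_sym_digraph) nonadjacent_sym: "nonadjacent G u v \<Longrightarrow> nonadjacent G v u"
  using arcs_symmetric unfolding nonadjacent_def by blast

lemma (in pair_graph) complement_2K2_free_if_no_induced_C4:
  assumes no_C4: "\<not> (\<exists>vs. induced_cycle G vs \<and> length vs = 4)"
  shows "complement_2K2_free G"
proof (rule ccontr)
  assume "\<not> complement_2K2_free G"
  then obtain a b c d where nonadj: "nonadjacent G a b" "nonadjacent G c d"
    and apart: "\<forall>u \<in> {a, b}. \<forall>v \<in> {c, d}. u \<noteq> v \<and> \<not> nonadjacent G u v"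
    unfolding complement_2K2_free_def by blast
  have verts: "{a, b, c, d} \<subseteq> pverts G" and "a \<noteq> b" "c \<noteq> d"
    using nonadj by (auto simp: nonadjacent_def)
  have cross: "u \<noteq> v" "\<not> nonadjacent G u v" if "u \<in> {a, b}" "v \<in> {c, d}" for u v
    using apart that by blast+
  have neq: "distinct [a, c, b, d]"
    using cross(1) \<open>a \<noteq> b\<close> \<open>c \<noteq> d\<close> by fastforce
  have arc: "(u, v) \<in> parcs G" "(v, u) \<in> parcs G" if "u \<in> {a, b}" "v \<in> {c, d}" for u v
    using cross[OF that] that verts arcs_symmetric[of u v] by (auto simp: nonadjacent_def)
  have no_arc: "(a, b) \<notin> parcs G" "(b, a) \<notin> parcs G" "(c, d) \<notin> parcs G" "(d, c) \<notin> parcs G"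
    using nonadj nonadj[THEN nonadjacent_sym] unfolding nonadjacent_def by blast+
  have no_loop: "(u, u) \<notin> parcs G" for u
    using no_loops' by blast
  have "induced_cycle G [a, c, b, d]"
    using verts neq by (auto simp: induced_cycle_def less_Suc_eq arc no_arc no_loop)
  with no_C4 show False
    by fastforce
qed

lemma (in pair_sym_digraph) cocomparability_graph_by_ranking:
  fixes rank :: "'a \<Rightarrow> 'b :: linorder"
  assumes neq: "\<And>u v. nonadjacent G u v \<Longrightarrow> rank u \<noteq> rank v"
    and trans: "\<And>u v w. nonadjacent G u v \<Longrightarrow> nonadjacent G v w \<Longrightarrow>
      rank u < rank v \<Longrightarrow> rank v < rank w \<Longrightarrow> nonadjacent G u w"
  shows "cocomparability_graph G"
  unfolding cocomparability_graph_def
proof (intro exI conjI allI)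
  let ?R = "\<lambda>u v. nonadjacent G u v \<and> rank u < rank v"
  show "transp ?R"
    using trans by (intro transpI) (meson less_trans)
  show "nonadjacent G u v \<longleftrightarrow> ?R u v \<or> ?R v u" for u v
    using neq[of u v] nonadjacent_sym by auto
qed

lemma card_predecessors_less:
  assumes fin: "finite A"
    and two_plus_two_free: "\<And>a b c d. {a, b, c, d} \<subseteq> A \<Longrightarrow> R a b \<Longrightarrow> R c d \<Longrightarrow> R a d \<or> R c b"
    and "u \<in> A" "v \<in> A" "w \<in> A" and "R u v" "\<not> R u w"
  shows "card {t \<in> A. R t w} < card {t \<in> A. R t v}"
proof (rule psubset_card_mono)
  have "R t v" if "t \<in> A" "R t w" for t
    using two_plus_two_free[of u v t w] assms that by simp
  then show "{t \<in> A. R t w} \<subset> {t \<in> A. R t v}"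
    using assms by blast
qed (use fin in simp)

lemma interval_order_representation:
  assumes fin: "finite A" and irrefl: "\<And>u. u \<in> A \<Longrightarrow> \<not> R u u"
    and two_plus_two_free: "\<And>a b c d. {a, b, c, d} \<subseteq> A \<Longrightarrow> R a b \<Longrightarrow> R c d \<Longrightarrow> R a d \<or> R c b"
  obtains l r :: "'a \<Rightarrow> nat"
  where "\<And>u v. u \<in> A \<Longrightarrow> v \<in> A \<Longrightarrow> R u v \<longleftrightarrow> r u < l v"
proof -
  define l where "l v = card {u \<in> A. R u v}" for v
  define r where "r u = Max (l ` {v \<in> A. \<not> R u v})" for u
  have "R u v \<longleftrightarrow> r u < l v" if uv: "u \<in> A" "v \<in> A" for u v
  proof
    assume "R u v"
    have "l w < l v" if "w \<in> A" "\<not> R u w" for w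
      unfolding l_def
      using fin two_plus_two_free uv that(1) \<open>R u v\<close> that(2) by (rule card_predecessors_less)
    moreover have "l ` {w \<in> A. \<not> R u w} \<noteq> {}"
      using irrefl uv by blast
    ultimately show "r u < l v"
      using fin by (simp add: r_def)
  next
    assume "r u < l v"
    moreover have "l v \<le> r u" if "\<not> R u v"
      using fin uv that by (simp add: r_def)
    ultimately show "R u v"
      by fastforce
  qed
  then show thesis
    by (rule that)
qed

lemma interval_graph_if_interval_order:
  assumes fin: "finite (pverts G)"
    and nonadj: "\<And>u v. nonadjacent G u v \<longleftrightarrow> R u v \<or> R v u"
    and two_plus_two_free: "\<And>a b c d. R a b \<Longrightarrow> R c d \<Longrightarrow> R a d \<or> R c b"
  shows "interval_graph G"
proof -
  have irrefl: "\<not> R u u" for u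
    using nonadj[of u u] by (simp add: nonadjacent_def)
  obtain l r :: "'a \<Rightarrow> nat" where
    lr: "\<And>u v. u \<in> pverts G \<Longrightarrow> v \<in> pverts G \<Longrightarrow> R u v \<longleftrightarrow> r u < l v"
    using interval_order_representation[OF fin, of R] irrefl two_plus_two_free by metis
  define I where "I v = {real (l v)..real (r v)}" for v
  have le: "l v \<le> r v" if "v \<in> pverts G" for v
    using lr[of v v] irrefl that by simp
  have "is_interval (I v) \<and> I v \<noteq> {}" if "v \<in> pverts G" for v
    using le[OF that] by (simp add: I_def is_interval_cc)
  moreover have "(u, v) \<in> parcs G \<longleftrightarrow> I u \<inter> I v \<noteq> {}"
    if uv: "u \<in> pverts G" "v \<in> pverts G" "u \<noteq> v" for u v
  proof -
    have "(u, v) \<in> parcs G \<longleftrightarrow> \<not> R u v \<and> \<not> R v u"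
      using nonadj[of u v] uv by (auto simp: nonadjacent_def)
    also have "\<dots> \<longleftrightarrow> l v \<le> r u \<and> l u \<le> r v"
      using lr uv by auto
    also have "\<dots> \<longleftrightarrow> I u \<inter> I v \<noteq> {}"
      using le uv by (auto simp: I_def)
    finally show ?thesis .
  qed
  ultimately show ?thesis
    unfolding interval_graph_def by blast
qed

lemma interval_graph_if_cocomparability_graph:
  assumes "finite (pverts G)" "cocomparability_graph G" "complement_2K2_free G"
  shows "interval_graph G"
proof -
  obtain R where trans: "transp R" and nonadj: "\<And>u v. nonadjacent G u v \<longleftrightarrow> R u v \<or> R v u"
    using assms(2) unfolding cocomparability_graph_def by blast
  show ?thesis
  proof (rule interval_graph_if_interval_order[OF assms(1) nonadj])
    fix a b c d
    assume "R a b" "R c d"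
    then obtain u v where "u \<in> {a, b}" "v \<in> {c, d}" "u = v \<or> R u v \<or> R v u"
      using assms(3) nonadj unfolding complement_2K2_free_def by metis
    with \<open>R a b\<close> \<open>R c d\<close> show "R a d \<or> R c b"
      using transpD[OF trans] by blast
  qed
qed

section \<open>Competition in terms of out-neighbourhoods\<close>

definition out_nbhd :: "('a, 'b) pre_digraph \<Rightarrow> 'a \<Rightarrow> 'a set" where
  "out_nbhd G u = {v. u \<rightarrow>\<^bsub>G\<^esub> v}"

lemma ddist_le_iff:
  "ddist D x y \<le> enat n \<longleftrightarrow> (\<exists>p. pre_digraph.apath D x p y \<and> length p \<le> n)"
proof
  let ?L = "(\<lambda>p. enat (length p)) ` {p. pre_digraph.apath D x p y}"
  assume le: "ddist D x y \<le> enat n"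
  have "?L \<noteq> {}"
  proof
    assume "?L = {}"
    then have "ddist D x y = \<infinity>"
      unfolding ddist_def by (simp only: Inf_empty top_enat_def)
    then show False
      using le by simp
  qed
  then have "ddist D x y \<in> ?L"
    unfolding ddist_def by (metis ex_in_conv wellorder_InfI)
  then show "\<exists>p. pre_digraph.apath D x p y \<and> length p \<le> n"
    using le by auto
next
  assume "\<exists>p. pre_digraph.apath D x p y \<and> length p \<le> n"
  then show "ddist D x y \<le> enat n"
    unfolding ddist_def by (auto intro: INF_lower2)
qed

context wf_digraph
begin

lemma apath_singleton_iff:
  assumes "x \<noteq> y"
  shows "(\<exists>e. apath x [e] y) \<longleftrightarrow> y \<in> out_nbhd G x"
  using assms by (auto simp: apath_simps out_nbhd_def arcs_ends_conv)

lemma ddist_le_1_iff: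
  assumes "x \<noteq> y"
  shows "ddist G x y \<le> 1 \<longleftrightarrow> y \<in> out_nbhd G x"
proof -
  have "ddist G x y \<le> 1 \<longleftrightarrow> (\<exists>p. apath x p y \<and> length p \<le> 1)"
    using ddist_le_iff[of G x y 1] by (simp add: one_enat_def)
  also have "\<dots> \<longleftrightarrow> (\<exists>e. apath x [e] y)"
    using assms by (auto simp: le_Suc_eq length_Suc_conv apath_Nil_iff)
  finally show ?thesis
    by (simp only: apath_singleton_iff[OF assms])
qed

lemma ddist_le_2_iff:
  assumes "x \<noteq> y"
  shows "ddist G x y \<le> 2 \<longleftrightarrow> y \<in> out_nbhd G x \<or> (\<exists>z \<in> out_nbhd G x. y \<in> out_nbhd G z)"
proof -
  have "ddist G x y \<le> 2 \<longleftrightarrow> (\<exists>p. apath x p y \<and> length p \<le> 2)"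
    using ddist_le_iff[of G x y 2] by (simp add: numeral_eq_enat)
  also have "\<dots> \<longleftrightarrow> (\<exists>e. apath x [e] y) \<or> (\<exists>e f. apath x [e, f] y)"
    using assms by (auto simp: le_Suc_eq length_Suc_conv numeral_2_eq_2 apath_Nil_iff)
  also have "(\<exists>e f. apath x [e, f] y) \<longleftrightarrow> (\<exists>z \<in> out_nbhd G x - {x, y}. y \<in> out_nbhd G z)"
  proof
    assume "\<exists>e f. apath x [e, f] y"
    then show "\<exists>z \<in> out_nbhd G x - {x, y}. y \<in> out_nbhd G z"
      by (auto simp: apath_simps out_nbhd_def arcs_ends_conv)
  next
    assume "\<exists>z \<in> out_nbhd G x - {x, y}. y \<in> out_nbhd G z"
    then obtain z where z: "x \<rightarrow> z" "z \<rightarrow> y" "z \<noteq> x" "z \<noteq> y"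
      by (auto simp: out_nbhd_def)
    from z(1) obtain e where "e \<in> arcs G" "tail G e = x" "head G e = z"
      by (rule reachableE)
    moreover from z(2) obtain f where "f \<in> arcs G" "tail G f = z" "head G f = y"
      by (rule reachableE)
    ultimately have "apath x [e, f] y"
      using assms z by (auto simp: apath_simps)
    then show "\<exists>e f. apath x [e, f] y"
      by blast
  qed
  also have "(\<exists>e. apath x [e] y) \<longleftrightarrow> y \<in> out_nbhd G x"
    by (rule apath_singleton_iff[OF assms])
  finally show ?thesis
    by blast
qed

lemma out_nbhd_del_vert:
  "out_nbhd (del_vert v) u = (if u = v then {} else out_nbhd G u - {v})"
  by (auto simp: out_nbhd_def arcs_ends_conv del_vert_simps)

lemma ddist_del_vert_le_1_iff:
  assumes "w \<notin> {u, v}" "u \<noteq> v"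
  shows "ddist (del_vert v) u w \<le> 1 \<longleftrightarrow> w \<in> out_nbhd G u"
  using wf_digraph.ddist_le_1_iff[OF wf_digraph_del_vert, of u w v] assms
  by (auto simp: out_nbhd_del_vert)

lemma ddist_del_vert_le_2_iff:
  assumes "w \<notin> {u, v}" "u \<noteq> v"
  shows "ddist (del_vert v) u w \<le> 2 \<longleftrightarrow>
    w \<in> out_nbhd G u \<or> (\<exists>z \<in> out_nbhd G u - {v}. w \<in> out_nbhd G z)"
  using wf_digraph.ddist_le_2_iff[OF wf_digraph_del_vert, of u w v] assms
  by (auto simp: out_nbhd_del_vert)

end

lemma (in loopfree_digraph) step_competes_iff:
  assumes "u \<noteq> v"
  shows "step_competes G u v \<longleftrightarrow>
    (\<exists>a \<in> out_nbhd G u - {v}. \<exists>b \<in> out_nbhd G v - {u}.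
       a = b \<or> a \<in> out_nbhd G b \<or> b \<in> out_nbhd G a)"
    (is "_ \<longleftrightarrow> ?R")
proof -
  let ?N = "out_nbhd G"
  have N: "x \<notin> ?N x" "?N x \<subseteq> verts G" for x
    using adj_not_same adj_in_verts by (auto simp: out_nbhd_def)
  have "step_competes G u v \<longleftrightarrow> (\<exists>w \<in> verts G. w \<notin> {u, v} \<and>
     (w \<in> ?N u \<and> (w \<in> ?N v \<or> (\<exists>z \<in> ?N v - {u}. w \<in> ?N z)) \<or>
      w \<in> ?N v \<and> (w \<in> ?N u \<or> (\<exists>z \<in> ?N u - {v}. w \<in> ?N z))))"
    (is "_ \<longleftrightarrow> ?L")
    unfolding step_competes_def using assms
    by (intro bex_cong refl)
      (auto simp: ddist_del_vert_le_1_iff ddist_del_vert_le_2_iff insert_commute)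
  also have "?L \<longleftrightarrow> ?R"
  proof
    assume ?L
    then show ?R by blast
  next
    assume ?R
    then obtain a b where "a \<in> ?N u" "a \<noteq> v" "b \<in> ?N v" "b \<noteq> u" "a = b \<or> a \<in> ?N b \<or> b \<in> ?N a"
      by blast
    moreover from this have "a \<noteq> u" "b \<noteq> v" "a \<in> verts G" "b \<in> verts G"
      using N by blast+
    ultimately show ?L by blast
  qed
  finally show ?thesis .
qed

section \<open>Multipartite tournaments\<close>

locale multipartite_tournament_digraph =
  fixes D :: "('a, 'b) pre_digraph" (structure) and P :: "'a set set"
  assumes multipartite_tournament: "multipartite_tournament D P"
begin

sublocale digraph D
  using multipartite_tournament by (simp add: multipartite_tournament_def)

abbreviation competition_graph :: "'a pair_pre_digraph" where
  "competition_graph \<equiv> step_competition_graph D"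

abbreviation N :: "'a \<Rightarrow> 'a set" where
  "N \<equiv> out_nbhd D"

abbreviation linked :: "'a \<Rightarrow> 'a \<Rightarrow> bool" (infix "\<bowtie>" 50) where
  "u \<bowtie> v \<equiv> nonadjacent competition_graph u v"

sublocale competition: pair_graph competition_graph
  using digraph_axioms by (rule pair_graph_step_competition_graph)

lemmas linked_sym = competition.nonadjacent_sym

lemma linked_iff:
  "u \<bowtie> v \<longleftrightarrow> u \<in> verts D \<and> v \<in> verts D \<and> u \<noteq> v \<and>
     (\<forall>a \<in> N u - {v}. \<forall>b \<in> N v - {u}. a \<noteq> b \<and> a \<notin> N b \<and> b \<notin> N a)"
  using step_competes_iff[of u v]
  by (auto simp: nonadjacent_def step_competition_graph_def)

lemma linked_verts: "u \<bowtie> v \<Longrightarrow> u \<in> verts D \<and> v \<in> verts D \<and> u \<noteq> v"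
  by (simp add: linked_iff)

lemma N_subset_verts: "N u \<subseteq> verts D"
  using adj_in_verts by (auto simp: out_nbhd_def)

lemma in_N_imp_in_verts: "v \<in> N u \<Longrightarrow> u \<in> verts D"
  using adj_in_verts by (auto simp: out_nbhd_def)

lemma not_in_own_N: "u \<notin> N u"
  using adj_not_same by (auto simp: out_nbhd_def)

lemma partition: "partition_on (verts D) P"
  using multipartite_tournament by (simp add: multipartite_tournament_def)

lemma part_subset_verts: "Z \<in> P \<Longrightarrow> Z \<subseteq> verts D"
  using partition_onD1[OF partition] by blast

lemma part_exists:
  assumes "u \<in> verts D"
  obtains Z where "Z \<in> P" "u \<in> Z"
  using assms partition_onD1[OF partition] by blast

lemma parts_disjoint: "Z \<in> P \<Longrightarrow> Z' \<in> P \<Longrightarrow> Z \<noteq> Z' \<Longrightarrow> u \<in> Z \<Longrightarrow> u \<notin> Z'"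
  using partition_onD2[OF partition] by (auto simp: disjoint_def)

lemma no_arc_in_part: "Z \<in> P \<Longrightarrow> u \<in> Z \<Longrightarrow> v \<in> Z \<Longrightarrow> v \<notin> N u"
  using multipartite_tournament by (fastforce simp: multipartite_tournament_def out_nbhd_def)

lemma one_arc_between_parts:
  assumes "Z \<in> P" "u \<in> Z" "v \<in> verts D" "v \<notin> Z"
  shows "v \<in> N u \<longleftrightarrow> u \<notin> N v"
proof -
  obtain Z' where "Z' \<in> P" "v \<in> Z'"
    using part_exists assms(3) by blast
  moreover from this have "Z \<noteq> Z'"
    using assms(4) by blast
  ultimately show ?thesis
    using multipartite_tournament assms(1,2)
    unfolding multipartite_tournament_def out_nbhd_def by simp metis
qed

lemma linked_N_disjoint:
  assumes "u \<bowtie> v"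
  shows "N u \<inter> N v = {}"
  using assms not_in_own_N unfolding linked_iff by blast

lemma linked_N_same_part:
  assumes "u \<bowtie> v" and a: "a \<in> N u - {v}" and b: "b \<in> N v - {u}" and Z: "Z \<in> P"
  shows "a \<in> Z \<longleftrightarrow> b \<in> Z"
proof -
  have "a \<notin> N b" "b \<notin> N a"
    using assms unfolding linked_iff by blast+
  then show ?thesis
    using one_arc_between_parts[OF Z, of a b] one_arc_between_parts[OF Z, of b a]
      N_subset_verts a b by blast
qed

lemma linkedI:
  assumes "u \<in> verts D" "v \<in> verts D" "u \<noteq> v" "Z \<in> P" "N u \<subseteq> Z" "N v \<subseteq> Z" "N u \<inter> N v = {}"
  shows "u \<bowtie> v"
  unfolding linked_iff using assms no_arc_in_part by blast

lemma linked_if_N_singleton: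
  assumes "N u = {v}"
  shows "u \<bowtie> v"
proof -
  have "v \<in> N u"
    using assms by simp
  then have "u \<in> verts D" "v \<in> verts D" "u \<noteq> v"
    using in_N_imp_in_verts N_subset_verts not_in_own_N by blast+
  then show ?thesis
    using assms by (simp add: linked_iff)
qed

lemma linked_pair_if_not_competing:
  assumes "Z \<in> P" "\<not> step_competing D Z"
  obtains u v where "u \<in> Z" "v \<in> Z" "u \<bowtie> v"
  using assms part_subset_verts[OF assms(1)]
  by (auto simp: step_competing_def is_clique_def nonadjacent_def step_competition_graph_def)

lemma dominates_not_competing_part:
  assumes Z: "Z \<in> P" "\<not> step_competing D Z" and u: "u \<in> verts D" "u \<notin> Z"
  shows "N u \<inter> Z \<noteq> {}"
proof -
  obtain a b where ab: "a \<in> Z" "b \<in> Z" "a \<bowtie> b"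
    using Z by (rule linked_pair_if_not_competing)
  then have "u \<notin> N a \<or> u \<notin> N b"
    using linked_N_disjoint by blast
  then show ?thesis
    using one_arc_between_parts[OF Z(1) _ u] ab by blast
qed

end

section \<open>Two partite sets that are not competing\<close>

locale two_noncompeting_parts = multipartite_tournament_digraph +
  fixes X Y :: "'a set"
  assumes X: "X \<in> P" "\<not> step_competing D X"
    and Y: "Y \<in> P" "\<not> step_competing D Y"
    and X_neq_Y: "X \<noteq> Y"
begin

lemma swap: "two_noncompeting_parts D P Y X"
  using X Y X_neq_Y by unfold_locales auto

lemma disjoint_XY: "x \<in> X \<Longrightarrow> x \<notin> Y"
  using parts_disjoint X(1) Y(1) X_neq_Y by blast

lemma X_subset_verts: "X \<subseteq> verts D"
  using X(1) by (rule part_subset_verts)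

lemmas Y_subset_verts = two_noncompeting_parts.X_subset_verts[OF swap]

lemma arc_XY_iff: "x \<in> X \<Longrightarrow> y \<in> Y \<Longrightarrow> y \<in> N x \<longleftrightarrow> x \<notin> N y"
  using one_arc_between_parts[OF X(1)] Y_subset_verts disjoint_XY by blast

lemma dominates_X:
  assumes "u \<in> verts D" "u \<notin> X"
  obtains x where "x \<in> X" "x \<in> N u"
  using dominates_not_competing_part[OF X assms] by blast

lemmas dominates_Y = two_noncompeting_parts.dominates_X[OF swap]

lemma N_nonempty: "u \<in> verts D \<Longrightarrow> N u \<noteq> {}"
  using dominates_X dominates_Y disjoint_XY by (metis empty_iff)

lemma linked_in_X_iff:
  assumes x: "x \<in> X" "x' \<in> X"
  shows "x \<bowtie> x' \<longleftrightarrow> x \<noteq> x' \<and> N x \<subseteq> Y \<and> N x' \<subseteq> Y \<and> N x \<inter> N x' = {}"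
proof
  assume link: "x \<bowtie> x'"
  have N_Y: "N a \<subseteq> Y" if ab: "a \<in> X" "b \<in> X" "a \<bowtie> b" for a b
  proof
    fix z
    assume "z \<in> N a"
    obtain y where "y \<in> Y" "y \<in> N b"
      using dominates_Y[of b] disjoint_XY X_subset_verts ab(2) by blast
    moreover have "z \<noteq> b" "y \<noteq> a"
      using no_arc_in_part[OF X(1)] ab \<open>z \<in> N a\<close> \<open>y \<in> N b\<close> by blast+
    ultimately show "z \<in> Y"
      using linked_N_same_part[OF ab(3) _ _ Y(1)] \<open>z \<in> N a\<close> by blast
  qed
  have "x' \<bowtie> x"
    using link by (rule linked_sym)
  then show "x \<noteq> x' \<and> N x \<subseteq> Y \<and> N x' \<subseteq> Y \<and> N x \<inter> N x' = {}"
    using N_Y x link linked_verts linked_N_disjoint by blast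
next
  assume "x \<noteq> x' \<and> N x \<subseteq> Y \<and> N x' \<subseteq> Y \<and> N x \<inter> N x' = {}"
  then show "x \<bowtie> x'"
    using linkedI[OF _ _ _ Y(1)] x X_subset_verts by blast
qed

lemmas linked_in_Y_iff = two_noncompeting_parts.linked_in_X_iff[OF swap]

lemma dominates_linked_pair_in_X:
  assumes "u \<in> verts D" "u \<notin> X \<union> Y" "x \<in> X" "x' \<in> X" "x \<bowtie> x'"
  shows "x \<in> N u" "x' \<in> N u"
proof -
  have "u \<notin> N x" "u \<notin> N x'"
    using linked_in_X_iff assms by blast+
  then show "x \<in> N u" "x' \<in> N u"
    using one_arc_between_parts[OF X(1) _ assms(1)] assms by blast+
qed

lemmas dominates_linked_pair_in_Y = two_noncompeting_parts.dominates_linked_pair_in_X[OF swap]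

lemma linked_in_XY:
  assumes "u \<bowtie> v"
  shows "u \<in> X \<union> Y"
proof (rule ccontr)
  assume u: "u \<notin> X \<union> Y"
  have verts: "u \<in> verts D" "v \<in> verts D"
    using assms linked_verts by blast+
  obtain x x' where x: "x \<in> X" "x' \<in> X" "x \<bowtie> x'"
    using X by (rule linked_pair_if_not_competing)
  obtain y y' where y: "y \<in> Y" "y' \<in> Y" "y \<bowtie> y'"
    using Y by (rule linked_pair_if_not_competing)
  have "{x, x', y, y'} \<subseteq> N u"
    using dominates_linked_pair_in_X[OF verts(1) u x]
      dominates_linked_pair_in_Y[OF verts(1) _ y] u by blast
  moreover have "x \<noteq> x'" "y \<noteq> y'"
    using x y linked_verts by blast+
  ultimately obtain a b where a: "a \<in> X" "a \<in> N u - {v}" and b: "b \<in> Y" "b \<in> N u - {v}"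
    using x y by blast
  obtain c where c: "c \<in> N v - {u}"
  proof (cases "v \<in> X")
    case True
    then show thesis
      using that dominates_Y[OF verts(2)] disjoint_XY u by blast
  next
    case False
    then show thesis
      using that dominates_X[OF verts(2)] u by blast
  qed
  have "c \<in> X"
    using linked_N_same_part[OF assms a(2) c X(1)] a(1) by blast
  moreover have "c \<in> Y"
    using linked_N_same_part[OF assms b(2) c Y(1)] b(1) by blast
  ultimately show False
    using disjoint_XY by blast
qed

lemma linked_XY_iff:
  assumes xy: "x \<in> X" "y \<in> Y"
  shows "x \<bowtie> y \<longleftrightarrow> N x = {y} \<or> N y = {x}"
proof
  assume link: "x \<bowtie> y"
  obtain y' where y': "y' \<in> Y" "y' \<in> N x"
    using dominates_Y xy disjoint_XY X_subset_verts by blast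
  obtain x' where x': "x' \<in> X" "x' \<in> N y"
    using dominates_X xy disjoint_XY Y_subset_verts by blast
  show "N x = {y} \<or> N y = {x}"
  proof (rule ccontr)
    assume "\<not> ?thesis"
    then obtain a b where a: "a \<in> N x - {y}" and b: "b \<in> N y - {x}"
      using x' y' by blast
    have "a \<notin> X" "b \<notin> Y"
      using no_arc_in_part X(1) Y(1) xy a b by blast+
    then have "N x \<inter> Y \<subseteq> {y}" "N y \<inter> X \<subseteq> {x}"
      using linked_N_same_part[OF link _ b Y(1)] linked_N_same_part[OF link a _ X(1)] by blast+
    then have "y \<in> N x" "x \<in> N y"
      using x' y' by blast+
    then show False
      using arc_XY_iff xy by blast
  qed
next
  assume "N x = {y} \<or> N y = {x}"
  then show "x \<bowtie> y"
    using linked_if_N_singleton linked_sym by blast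
qed

lemma N_singleton_across:
  assumes "N u = {v}"
  shows "u \<in> X \<and> v \<in> Y \<or> u \<in> Y \<and> v \<in> X"
proof -
  have "u \<bowtie> v" "v \<bowtie> u"
    using linked_if_N_singleton[OF assms] linked_sym by blast+
  then have "u \<in> X \<union> Y" "v \<in> X \<union> Y"
    by (auto dest: linked_in_XY)
  moreover have "v \<in> N u"
    using assms by simp
  ultimately show ?thesis
    using no_arc_in_part X(1) Y(1) by blast
qed

lemma in_Y_if_N_singleton_in_X: "N y = {x} \<Longrightarrow> x \<in> X \<Longrightarrow> y \<in> Y"
  using N_singleton_across disjoint_XY by blast

lemmas in_X_if_N_singleton_in_Y = two_noncompeting_parts.in_Y_if_N_singleton_in_X[OF swap]

lemma N_singleton_is_end_of_link_in_X:
  assumes "N y = {x}" "x \<in> X" "c \<in> X" "d \<in> X" "c \<bowtie> d"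
  shows "x \<in> {c, d}"
proof (rule ccontr)
  assume "x \<notin> {c, d}"
  moreover have "y \<in> Y"
    using assms(1,2) by (rule in_Y_if_N_singleton_in_X)
  ultimately have "y \<in> N c" "y \<in> N d"
    using arc_XY_iff assms by auto
  then show False
    using linked_N_disjoint assms(5) by blast
qed

lemmas N_singleton_is_end_of_link_in_Y =
  two_noncompeting_parts.N_singleton_is_end_of_link_in_X[OF swap]

lemma dominated_by_one_of_linked_in_Y:
  assumes "x \<in> X" "x' \<in> X" "x \<bowtie> x'" and "y \<in> Y" "y' \<in> Y" "y \<bowtie> y'"
  shows "x \<in> N y \<longleftrightarrow> x \<notin> N y'"
proof -
  have "N x \<inter> N x' = {}" "N y \<inter> N y' = {}"
    using assms linked_N_disjoint by blast+
  then show ?thesis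
    using arc_XY_iff[of x y] arc_XY_iff[of x y'] arc_XY_iff[of x' y] arc_XY_iff[of x' y'] assms
    by blast
qed

section \<open>Transitive orientations of the links\<close>

lemma cocomparability_if_N_singletons_one_sided:
  assumes y0: "N y0 = {x0}" "x0 \<in> X" and one_sided: "\<And>x. x \<in> X \<Longrightarrow> \<not> is_singleton (N x)"
  shows "cocomparability_graph competition_graph"
proof -
  define S where "S = X - {x0} \<union> {y \<in> Y. x0 \<in> N y}"
  obtain c d where cd: "c \<in> X" "d \<in> X" "c \<bowtie> d"
    using X by (rule linked_pair_if_not_competing)
  then obtain x1 where x1: "x1 \<in> X" "x0 \<bowtie> x1"
    using N_singleton_is_end_of_link_in_X[OF y0 cd] linked_sym by blast
  have in_X: "u \<in> S \<longleftrightarrow> v \<notin> S" if "u \<in> X" "v \<in> X" "u \<bowtie> v" for u v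
    using N_singleton_is_end_of_link_in_X[OF y0 that] that linked_verts disjoint_XY
    by (auto simp: S_def)
  have in_Y: "u \<in> S \<longleftrightarrow> v \<notin> S" if "u \<in> Y" "v \<in> Y" "u \<bowtie> v" for u v
    using dominated_by_one_of_linked_in_Y[OF y0(2) x1 that] that disjoint_XY by (auto simp: S_def)
  have across: "u \<in> S \<longleftrightarrow> v \<notin> S" if "u \<in> X" "v \<in> Y" "u \<bowtie> v" for u v
  proof -
    have "N v = {u}"
      using linked_XY_iff one_sided that by (metis is_singletonI)
    then show ?thesis
      using that disjoint_XY by (auto simp: S_def)
  qed
  have "u \<in> S \<longleftrightarrow> v \<notin> S" if "u \<bowtie> v" for u v
    using in_X in_Y across linked_in_XY linked_sym that by (metis UnE)
  then show ?thesis
    by (intro competition.cocomparability_graph_by_ranking[of "\<lambda>u. if u \<in> S then 0 else 1 :: nat"])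
      (auto split: if_splits)
qed

lemma linked_opposite_N_singletons:
  assumes "N y = {x0}" "x0 \<in> X" "N x = {y0}" "y0 \<in> Y"
  shows "x0 \<bowtie> y0"
proof (cases "y = y0 \<or> x = x0")
  case True
  then show ?thesis
    using assms linked_if_N_singleton linked_sym by blast
next
  case False
  have "y \<in> Y" "x \<in> X"
    using assms in_Y_if_N_singleton_in_X in_X_if_N_singleton_in_Y by blast+
  then show ?thesis
    using arc_XY_iff[of x y] False assms by auto
qed

lemma N_singleton_linked_to_centres:
  assumes y: "N y = {x0}" "x0 \<in> X" and x: "N x = {y0}" "y0 \<in> Y"
    and uv: "N u = {v}" "u \<in> X" "v \<in> Y" "u \<noteq> x0" "v \<noteq> y0"
  shows "u \<bowtie> x0" "v \<bowtie> y0"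
proof -
  have "y \<in> Y"
    using y by (rule in_Y_if_N_singleton_in_X)
  then have "y \<in> N u"
    using arc_XY_iff[of u y] uv(2,4) y(1) by simp
  then have "x0 \<in> N v"
    using uv(1) y(1) by simp
  then have "v \<notin> N x0"
    using arc_XY_iff y(2) uv(3) by blast
  obtain c d where cd: "c \<in> X" "d \<in> X" "c \<bowtie> d"
    using X by (rule linked_pair_if_not_competing)
  then have "N x0 \<subseteq> Y"
    using N_singleton_is_end_of_link_in_X[OF y cd] linked_in_X_iff by blast
  then show "u \<bowtie> x0"
    using linked_in_X_iff y(2) uv \<open>v \<notin> N x0\<close> by auto
  obtain a b where ab: "a \<in> Y" "b \<in> Y" "a \<bowtie> b"
    using Y by (rule linked_pair_if_not_competing)
  then have "v \<in> {a, b}" "y0 \<in> {a, b}"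
    using N_singleton_is_end_of_link_in_Y uv x by blast+
  then show "v \<bowtie> y0"
    using ab(3) uv(5) linked_sym by blast
qed

lemma link_across_linked_to_centres:
  assumes y: "N y = {x0}" "x0 \<in> X" and x: "N x = {y0}" "y0 \<in> Y"
    and uv: "u \<in> X" "v \<in> Y" "u \<bowtie> v" "u \<noteq> x0" "v \<noteq> y0"
  shows "u \<bowtie> x0" "v \<bowtie> y0"
proof -
  consider (N_u) "N u = {v}"
    | (N_v) "N v = {u}"
    using linked_XY_iff uv by blast
  then have "u \<bowtie> x0 \<and> v \<bowtie> y0"
  proof cases
    case N_u
    then show ?thesis
      using N_singleton_linked_to_centres[OF y x _ uv(1,2,4,5)] by blast
  next
    case N_v
    then show ?thesis
      using two_noncompeting_parts.N_singleton_linked_to_centres[OF swap x y _ uv(2,1,5,4)] by blast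
  qed
  then show "u \<bowtie> x0" "v \<bowtie> y0"
    by blast+
qed

definition layer :: "'a \<Rightarrow> 'a \<Rightarrow> 'a \<Rightarrow> nat" where
  "layer x0 y0 u = (if u = x0 then 0 else if u = y0 then 3 else if u \<in> Y then 1 else 2)"

lemma layer_le_3: "layer x0 y0 u \<le> 3"
  by (simp add: layer_def)

lemma layer_eq_0D: "layer x0 y0 u = 0 \<Longrightarrow> u = x0"
  by (simp add: layer_def split: if_splits)

lemma layer_eq_1D: "layer x0 y0 u = 1 \<Longrightarrow> u \<in> Y - {y0}"
  by (simp add: layer_def split: if_splits)

lemma layer_eq_2D: "layer x0 y0 u = 2 \<Longrightarrow> u \<bowtie> v \<Longrightarrow> u \<in> X - {x0}"
  using linked_in_XY by (auto simp: layer_def split: if_splits)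

lemma layer_eq_3D: "layer x0 y0 u = 3 \<Longrightarrow> u = y0"
  by (simp add: layer_def split: if_splits)

lemma layer_neq_if_linked:
  assumes y: "N y = {x0}" "x0 \<in> X" and x: "N x = {y0}" "y0 \<in> Y" and uv: "u \<bowtie> v"
  shows "layer x0 y0 u \<noteq> layer x0 y0 v"
proof
  assume eq: "layer x0 y0 u = layer x0 y0 v"
  consider (bottom) "layer x0 y0 v = 0"
    | (in_Y) "layer x0 y0 v = 1"
    | (in_X) "layer x0 y0 v = 2"
    | (top) "layer x0 y0 v = 3"
    using layer_le_3[of x0 y0 v] by linarith
  then show False
  proof cases
    case bottom
    then show False
      using eq layer_eq_0D linked_verts[OF uv] by metis
  next
    case in_Y
    then show False
      using layer_eq_1D[of x0 y0] eq N_singleton_is_end_of_link_in_Y[OF x _ _ uv] by auto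
  next
    case in_X
    then show False
      using layer_eq_2D[OF _ uv] layer_eq_2D[OF _ linked_sym[OF uv]] eq
        N_singleton_is_end_of_link_in_X[OF y _ _ uv] by auto
  next
    case top
    then show False
      using eq layer_eq_3D linked_verts[OF uv] by metis
  qed
qed

lemma linked_trans_along_layers:
  assumes y: "N y = {x0}" "x0 \<in> X" and x: "N x = {y0}" "y0 \<in> Y"
    and uv: "u \<bowtie> v" and vw: "v \<bowtie> w"
    and less: "layer x0 y0 u < layer x0 y0 v" "layer x0 y0 v < layer x0 y0 w"
  shows "u \<bowtie> w"
proof -
  consider (both_ends) "layer x0 y0 u = 0" "layer x0 y0 w = 3"
    | (bottom_end) "layer x0 y0 u = 0" "layer x0 y0 v = 1" "layer x0 y0 w = 2"
    | (top_end) "layer x0 y0 u = 1" "layer x0 y0 v = 2" "layer x0 y0 w = 3"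
    using less layer_le_3[of x0 y0 w] by linarith
  then show ?thesis
  proof cases
    case both_ends
    then have "u = x0" "w = y0"
      using layer_eq_0D layer_eq_3D by blast+
    then show ?thesis
      using linked_opposite_N_singletons[OF y x] by simp
  next
    case bottom_end
    have wv: "w \<bowtie> v"
      using vw by (rule linked_sym)
    then have "w \<in> X - {x0}" "v \<in> Y - {y0}"
      using bottom_end layer_eq_2D layer_eq_1D by blast+
    then have "x0 \<bowtie> w"
      using link_across_linked_to_centres(1)[OF y x _ _ wv] linked_sym by blast
    moreover have "u = x0"
      using bottom_end(1) by (rule layer_eq_0D)
    ultimately show ?thesis
      by simp
  next
    case top_end
    have vu: "v \<bowtie> u"
      using uv by (rule linked_sym)
    then have "v \<in> X - {x0}" "u \<in> Y - {y0}"
      using top_end layer_eq_2D layer_eq_1D by blast+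
    then have "u \<bowtie> y0"
      using link_across_linked_to_centres(2)[OF y x _ _ vu] by blast
    moreover have "w = y0"
      using top_end(3) by (rule layer_eq_3D)
    ultimately show ?thesis
      by simp
  qed
qed

lemma cocomparability_if_N_singletons_two_sided:
  assumes y: "N y = {x0}" "x0 \<in> X" and x: "N x = {y0}" "y0 \<in> Y"
  shows "cocomparability_graph competition_graph"
proof (rule competition.cocomparability_graph_by_ranking)
  show "layer x0 y0 u \<noteq> layer x0 y0 v" if "u \<bowtie> v" for u v
    using layer_neq_if_linked[OF y x that] .
  show "u \<bowtie> w" if "u \<bowtie> v" "v \<bowtie> w"
    "layer x0 y0 u < layer x0 y0 v" "layer x0 y0 v < layer x0 y0 w" for u v w
    using linked_trans_along_layers[OF y x that] .
qed

lemma cocomparability_if_complement_2K2_free: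
  assumes "complement_2K2_free competition_graph"
  shows "cocomparability_graph competition_graph"
proof -
  obtain x x' where x: "x \<in> X" "x' \<in> X" "x \<bowtie> x'"
    using X by (rule linked_pair_if_not_competing)
  obtain y y' where y: "y \<in> Y" "y' \<in> Y" "y \<bowtie> y'"
    using Y by (rule linked_pair_if_not_competing)
  obtain a b where "a \<in> {x, x'}" "b \<in> {y, y'}" "a = b \<or> a \<bowtie> b"
    using assms x(3) y(3) unfolding complement_2K2_free_def by blast
  then have ab: "a \<in> X" "b \<in> Y" "a \<bowtie> b"
    using x y disjoint_XY by auto
  consider (none_in_X) "\<And>u. u \<in> X \<Longrightarrow> \<not> is_singleton (N u)"
    | (none_in_Y) "\<And>u. u \<in> Y \<Longrightarrow> \<not> is_singleton (N u)"
    | (both) u v where "u \<in> X" "is_singleton (N u)" "v \<in> Y" "is_singleton (N v)"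
    by blast
  then show ?thesis
  proof cases
    case none_in_X
    then have "N b = {a}"
      using ab linked_XY_iff by (metis is_singletonI)
    then show ?thesis
      using cocomparability_if_N_singletons_one_sided ab(1) none_in_X by blast
  next
    case none_in_Y
    then have "N a = {b}"
      using ab linked_XY_iff by (metis is_singletonI)
    then show ?thesis
      using two_noncompeting_parts.cocomparability_if_N_singletons_one_sided[OF swap] ab(2)
        none_in_Y by blast
  next
    case both
    then obtain u' v' where "N u = {u'}" "N v = {v'}"
      by (auto simp: is_singleton_def)
    moreover from this have "u' \<in> Y" "v' \<in> X"
      using N_singleton_across both disjoint_XY by blast+
    ultimately show ?thesis
      using cocomparability_if_N_singletons_two_sided by blast
  qed
qed

section \<open>A partite set with at most three vertices\<close>

lemma linked_to_N_singleton_in_Y: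
  assumes y: "N y = {x}" "x \<in> X" and w: "w \<in> Y" "N w \<subseteq> X - {x}" "y \<noteq> w"
  shows "y \<bowtie> w"
proof -
  have "y \<in> Y"
    using y by (rule in_Y_if_N_singleton_in_X)
  then show ?thesis
    using linked_in_Y_iff[of y w] y w by auto
qed

lemma linked_to_N_singleton_across:
  assumes y: "N y = {x}" "x \<in> X" and ab: "a \<in> X" "b \<in> Y" "a \<bowtie> b" and neq: "a \<noteq> x" "y \<noteq> b"
  shows "y \<bowtie> b"
proof -
  have "y \<in> Y"
    using y by (rule in_Y_if_N_singleton_in_X)
  then have "y \<in> N a"
    using arc_XY_iff[OF ab(1)] y(1) neq(1) by simp
  then have "N b = {a}"
    using linked_XY_iff[OF ab(1,2)] ab(3) neq(2) by auto
  then show ?thesis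
    using linked_to_N_singleton_in_Y[OF y ab(2)] ab(1) neq by simp
qed

lemma linked_to_end_if_N_singleton_in_X:
  assumes y: "N y = {x}" "x \<in> X" and cd: "c \<bowtie> d"
  shows "\<exists>w \<in> {c, d}. y = w \<or> y \<bowtie> w"
proof (cases "x \<in> {c, d}")
  case True
  then show ?thesis
    using linked_if_N_singleton[OF y(1)] by blast
next
  case False
  have dc: "d \<bowtie> c"
    using cd by (rule linked_sym)
  consider (in_X) "c \<in> X" "d \<in> X"
    | (in_Y) "c \<in> Y" "d \<in> Y"
    | (across) "c \<in> X" "d \<in> Y"
    | (across_swapped) "d \<in> X" "c \<in> Y"
    using linked_in_XY[OF cd] linked_in_XY[OF dc] by blast
  then show ?thesis
  proof cases
    case in_X
    then show ?thesis
      using N_singleton_is_end_of_link_in_X[OF y _ _ cd] False by blast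
  next
    case in_Y
    then have "N c \<subseteq> X - {x} \<or> N d \<subseteq> X - {x}"
      using linked_in_Y_iff cd by blast
    then show ?thesis
      using linked_to_N_singleton_in_Y[OF y] in_Y by blast
  next
    case across
    then show ?thesis
      using linked_to_N_singleton_across[OF y _ _ cd] False by blast
  next
    case across_swapped
    then show ?thesis
      using linked_to_N_singleton_across[OF y _ _ dc] False by blast
  qed
qed

lemma linked_to_end_if_N_singleton:
  assumes "is_singleton (N s)" and cd: "c \<bowtie> d"
  shows "\<exists>w \<in> {c, d}. s = w \<or> s \<bowtie> w"
proof -
  obtain t where t: "N s = {t}"
    using assms(1) by (rule is_singletonE)
  then consider (in_X) "t \<in> X"
    | (in_Y) "t \<in> Y"
    using N_singleton_across by blast
  then show ?thesis
  proof cases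
    case in_X
    then show ?thesis
      using linked_to_end_if_N_singleton_in_X t cd by blast
  next
    case in_Y
    then show ?thesis
      using two_noncompeting_parts.linked_to_end_if_N_singleton_in_X[OF swap t _ cd] by blast
  qed
qed

lemma N_singleton_if_linked_in_Y:
  assumes card: "card X \<le> 3" and uv: "u \<in> Y" "v \<in> Y" "u \<bowtie> v"
  shows "is_singleton (N u) \<or> is_singleton (N v)"
proof -
  have sub: "N u \<subseteq> X" "N v \<subseteq> X" and disj: "N u \<inter> N v = {}"
    using linked_in_Y_iff uv by blast+
  have "finite X"
    using X_subset_verts finite_verts by (rule finite_subset)
  then have fin: "finite (N u)" "finite (N v)"
    using sub finite_subset by blast+
  have "card (N u) + card (N v) = card (N u \<union> N v)"
    using fin disj by (simp add: card_Un_disjoint)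
  also have "\<dots> \<le> 3"
    using card_mono[OF \<open>finite X\<close>, of "N u \<union> N v"] sub card by simp
  finally have "card (N u) + card (N v) \<le> 3" .
  moreover have "card (N u) \<noteq> 0" "card (N v) \<noteq> 0"
    using fin N_nonempty linked_verts uv(3) by auto
  ultimately have "card (N u) = 1 \<or> card (N v) = 1"
    by linarith
  then show ?thesis
    by (simp add: is_singleton_altdef)
qed

lemma N_singleton_if_linked_not_in_X:
  assumes card: "card X \<le> 3" and uv: "u \<bowtie> v" and not_X: "\<not> (u \<in> X \<and> v \<in> X)"
  shows "is_singleton (N u) \<or> is_singleton (N v)"
proof -
  have vu: "v \<bowtie> u"
    using uv by (rule linked_sym)
  then consider (in_Y) "u \<in> Y" "v \<in> Y"
    | (across) "u \<in> X" "v \<in> Y"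
    | (across_swapped) "v \<in> X" "u \<in> Y"
    using linked_in_XY[OF uv] linked_in_XY[OF vu] not_X by blast
  then show ?thesis
  proof cases
    case in_Y
    then show ?thesis
      using N_singleton_if_linked_in_Y[OF card] uv by blast
  next
    case across
    then show ?thesis
      using linked_XY_iff[of u v] uv by auto
  next
    case across_swapped
    then show ?thesis
      using linked_XY_iff[of v u] vu by auto
  qed
qed

lemma links_in_X_common_end:
  assumes card: "card X \<le> 3"
  obtains x where "\<And>u v. u \<in> X \<Longrightarrow> v \<in> X \<Longrightarrow> u \<bowtie> v \<Longrightarrow> x \<in> {u, v}"
proof -
  obtain y y' where y: "y \<in> Y" "y' \<in> Y" "y \<bowtie> y'"
    using Y by (rule linked_pair_if_not_competing)
  then obtain z x where z: "z \<in> Y" "N z = {x}"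
    using N_singleton_if_linked_in_Y[OF card] by (metis is_singletonE)
  moreover have "x \<in> X"
    using N_singleton_across[OF z(2)] disjoint_XY z(1) by blast
  ultimately show thesis
    using that N_singleton_is_end_of_link_in_X by blast
qed

lemma complement_2K2_free_if_card_le_3:
  assumes card: "card X \<le> 3"
  shows "complement_2K2_free competition_graph"
  unfolding complement_2K2_free_def
proof (intro allI impI)
  fix a b c d
  assume ab: "a \<bowtie> b" and cd: "c \<bowtie> d"
  consider (end_of_ab) s where "s \<in> {a, b}" "is_singleton (N s)"
    | (end_of_cd) s where "s \<in> {c, d}" "is_singleton (N s)"
    | (in_X) "a \<in> X" "b \<in> X" "c \<in> X" "d \<in> X"
    using N_singleton_if_linked_not_in_X[OF card ab] N_singleton_if_linked_not_in_X[OF card cd]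
    by blast
  then show "\<exists>u \<in> {a, b}. \<exists>v \<in> {c, d}. u = v \<or> u \<bowtie> v"
  proof cases
    case end_of_ab
    then show ?thesis
      using linked_to_end_if_N_singleton[OF _ cd] by blast
  next
    case end_of_cd
    then show ?thesis
      using linked_to_end_if_N_singleton[OF _ ab] linked_sym by metis
  next
    case in_X
    obtain x where "\<And>u v. u \<in> X \<Longrightarrow> v \<in> X \<Longrightarrow> u \<bowtie> v \<Longrightarrow> x \<in> {u, v}"
      using links_in_X_common_end[OF card] by blast
    then show ?thesis
      using ab cd in_X by blast
  qed
qed

lemma interval_graph_if_complement_2K2_free:
  assumes "complement_2K2_free competition_graph"
  shows "interval_graph competition_graph"
proof (rule interval_graph_if_cocomparability_graph)
  show "finite (pverts competition_graph)"
    by (simp add: step_competition_graph_def)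
qed (fact assms cocomparability_if_complement_2K2_free[OF assms])+

lemma interval_graph_if_card_le_3:
  assumes "card X \<le> 3 \<or> card Y \<le> 3"
  shows "interval_graph competition_graph"
  using assms complement_2K2_free_if_card_le_3 interval_graph_if_complement_2K2_free
    two_noncompeting_parts.complement_2K2_free_if_card_le_3[OF swap] by blast

end

theorem theorem4p9:
  fixes D :: "('a, 'b) pre_digraph" and P :: "'a set set"
  assumes "multipartite_tournament D P"
    and "card {X \<in> P. \<not> step_competing D X} = 2"
  shows "(interval_graph (step_competition_graph D) \<longleftrightarrow> chordal (step_competition_graph D)) \<and>
    (chordal (step_competition_graph D) \<longleftrightarrow>
       \<not> (\<exists>vs. induced_cycle (step_competition_graph D) vs \<and> length vs = 4)) \<and>
    ((\<exists>X \<in> P. \<forall>Y \<in> P - {X}. card Y \<le> 3) \<longrightarrow> interval_graph (step_competition_graph D))"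
proof -
  let ?G = "step_competition_graph D"
  let ?C4 = "\<exists>vs. induced_cycle ?G vs \<and> length vs = 4"
  obtain X Y where "{X \<in> P. \<not> step_competing D X} = {X, Y}" and neq: "X \<noteq> Y"
    using assms(2) by (auto simp: card_2_iff)
  then have XY: "X \<in> P" "\<not> step_competing D X" "Y \<in> P" "\<not> step_competing D Y"
    by blast+
  interpret two_noncompeting_parts D P X Y
    using assms(1) XY neq by unfold_locales
  have "\<not> ?C4" if "chordal ?G"
    using that unfolding chordal_def by auto
  moreover have "interval_graph ?G" if "\<not> ?C4"
    using competition.complement_2K2_free_if_no_induced_C4[OF that]
    by (rule interval_graph_if_complement_2K2_free)
  moreover have "interval_graph ?G" if "\<exists>Z \<in> P. \<forall>Z' \<in> P - {Z}. card Z' \<le> 3"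
    using that XY neq by (intro interval_graph_if_card_le_3) blast
  ultimately show ?thesis
    using interval_graph_imp_chordal[of ?G] by blast
qed

end
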